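(* Let $a\in\mathbb{R}_+^N$ and let $b:\mathbb{R}_+^N\times\mathbb{R}_+^N\to\mathbb{R}_+^N$ be a bilinear form such that $e=a+b(e,e)$. Let $x^\ast$ be the minimal nonnegative solution of the quadratic vector equation $x=a+b(x,x)$. Suppose that $R=b(e,\cdot)+b(\cdot,e)$ is irreducible and that $x^\ast>0$ (all entries strictly positive). Let $w$ be the Perron vector of $R^T$, and for $y\in\mathbb{R}^N$ put $$H_y:=b(\cdot,e)+b(e-y,\cdot).$$ Suppose that a sequence $\{y_k\}_k$ of positive vectors is generated by the Perron iteration, i.e. for each $k$ the matrix $H_{y_k}$ is nonnegative and irreducible and $y_{k+1}$ is the Perron vector of $H_{y_k}$, normalized so that $$w^T\bigl(y_{k+1}-b(y_{k+1},e)-b(e,y_{k+1})+b(y_{k+1},y_{k+1})\bigr)=0,$$ and suppose that $\{y_k\}_k$ converges to a vector $y^\ast$ such that $y^\ast\le e$. Then $x=e-y^\ast$ is the minimal nonnegative solution of $x=a+b(x,x)$.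
   Context: $\mathbb{R}_+^N=\{v\in\mathbb{R}^N: v_i\ge 0,\ i=1,\dots,N\}$; $e=(1,1,\dots,1)^T$. Vector inequalities are componentwise. A bilinear form $b:\mathbb{R}_+^N\times\mathbb{R}_+^N\to\mathbb{R}_+^N$ is given by nonnegative coefficients $b_{ijk}=e_i^Tb(e_j,e_k)\ge0$ (with $e_\ell$ the $\ell$-th canonical basis vector) via $(b(x,y))_i=\sum_{j,k}b_{ijk}x_jy_k$; it need not be symmetric, and the same formula extends it to $\mathbb{R}^N\times\mathbb{R}^N$. For fixed $y,z$, $b(y,\cdot)$ and $b(\cdot,z)$ denote the $N\times N$ matrices of the linear maps $v\mapsto b(y,v)$ and $v\mapsto b(v,z)$. The Perron vector of a nonnegative irreducible matrix is the entrywise positive eigenvector associated with its spectral radius, determined up to a positive scalar factor (which for $y_{k+1}$ is fixed by the normalization condition). The minimal nonnegative solution of the equation $x=a+b(x,x)$ is the nonnegative solution that is componentwise less than or equal to every other nonnegative solution; it is known to exist in this setting. *)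

theory Defs
  imports "HOL-Analysis.Analysis"
begin

text \<open>Vectors of size N live in \<open>real ^ 'n\<close> with \<open>N = CARD('n)\<close>. The library order on this type is
  the componentwise one, but its strict part only asks for one strict component; strict
  componentwise positivity is therefore \<open>pos_vec\<close>. The all-ones vector \<open>e\<close> is \<open>1\<close>.\<close>

definition pos_vec :: "real ^ 'n \<Rightarrow> bool" where
  "pos_vec v \<longleftrightarrow> (\<forall>i. 0 < v $ i)"

definition nonneg_bilinear :: "(real ^ 'n \<Rightarrow> real ^ 'n \<Rightarrow> real ^ 'n) \<Rightarrow> bool" where
  "nonneg_bilinear b \<longleftrightarrow> bilinear b \<and> (\<forall>i j k. 0 \<le> b (axis j 1) (axis k 1) $ i)"

definition minimal_nonneg_solution ::
  "real ^ 'n \<Rightarrow> (real ^ 'n \<Rightarrow> real ^ 'n \<Rightarrow> real ^ 'n) \<Rightarrow> real ^ 'n \<Rightarrow> bool" where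
  "minimal_nonneg_solution a b x \<longleftrightarrow>
     0 \<le> x \<and> x = a + b x x \<and> (\<forall>z. 0 \<le> z \<and> z = a + b z z \<longrightarrow> x \<le> z)"

definition nonneg_matrix :: "real ^ 'n ^ 'n \<Rightarrow> bool" where
  "nonneg_matrix A \<longleftrightarrow> (\<forall>i j. 0 \<le> A $ i $ j)"

text \<open>Irreducible: no simultaneous permutation of rows and columns brings the matrix into block
  triangular form with two nonempty square diagonal blocks; \<open>S\<close> and its complement are the index
  sets of the two blocks. Under this convention every 1 by 1 matrix is irreducible, also the
  zero matrix.\<close>

definition irreducible_matrix :: "real ^ 'n ^ 'n \<Rightarrow> bool" where
  "irreducible_matrix A \<longleftrightarrow>
     \<not> (\<exists>S. S \<noteq> {} \<and> S \<noteq> UNIV \<and> (\<forall>i\<in>S. \<forall>j\<in>-S. A $ i $ j = 0))"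

text \<open>The spectral radius of a real matrix takes all its complex eigenvalues into account. There are
  finitely many and at least one of them, so the maximum is well defined.\<close>

definition complex_eigenvalues :: "real ^ 'n ^ 'n \<Rightarrow> complex set" where
  "complex_eigenvalues A =
     {c. \<exists>v :: complex ^ 'n. v \<noteq> 0 \<and> map_matrix complex_of_real A *v v = c *s v}"

definition spectral_radius :: "real ^ 'n ^ 'n \<Rightarrow> real" where
  "spectral_radius A = Max (cmod ` complex_eigenvalues A)"

text \<open>A Perron vector is only determined up to a positive factor, so this is a predicate. It is
  meant for nonnegative irreducible \<open>A\<close>.\<close>

definition perron_vector :: "real ^ 'n ^ 'n \<Rightarrow> real ^ 'n \<Rightarrow> bool" where
  "perron_vector A v \<longleftrightarrow> pos_vec v \<and> A *v v = spectral_radius A *s v"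

definition R_mat :: "(real ^ 'n \<Rightarrow> real ^ 'n \<Rightarrow> real ^ 'n) \<Rightarrow> real ^ 'n ^ 'n" where
  "R_mat b = matrix (\<lambda>v. b 1 v) + matrix (\<lambda>v. b v 1)"

definition H_mat :: "(real ^ 'n \<Rightarrow> real ^ 'n \<Rightarrow> real ^ 'n) \<Rightarrow> real ^ 'n \<Rightarrow> real ^ 'n ^ 'n" where
  "H_mat b y = matrix (\<lambda>v. b v 1) + matrix (\<lambda>v. b (1 - y) v)"

definition perron_iteration ::
  "(real ^ 'n \<Rightarrow> real ^ 'n \<Rightarrow> real ^ 'n) \<Rightarrow> real ^ 'n \<Rightarrow> (nat \<Rightarrow> real ^ 'n) \<Rightarrow> bool" where
  "perron_iteration b w y \<longleftrightarrow>
     (\<forall>k. pos_vec (y k) \<and>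
          nonneg_matrix (H_mat b (y k)) \<and> irreducible_matrix (H_mat b (y k)) \<and>
          perron_vector (H_mat b (y k)) (y (Suc k)) \<and>
          w \<bullet> (y (Suc k) - b (y (Suc k)) 1 - b 1 (y (Suc k)) + b (y (Suc k)) (y (Suc k))) = 0)"

end

theory Submission
  imports Defs
begin

text \<open>Write \<open>e\<close> for the vector \<open>1\<close>, \<open>x\<^sup>*\<close> for the minimal solution \<open>xs\<close>, \<open>y\<^sup>*\<close> for the limit
  \<open>ys\<close>, and \<open>\<rho>\<close> for the eigenvalue belonging to \<open>w\<close>. In terms of \<open>v = e - x\<close> the equation
  \<open>x = a + b(x,x)\<close> becomes \<open>v = b(v,e) + b(e - v,v)\<close>, that is \<open>H\<^sub>v v = v\<close>. The proof
  distinguishes whether the limit vanishes.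

  If \<open>y\<^sup>* \<noteq> 0\<close>, then \<open>w \<bullet> y\<^sup>* > 0\<close>, and the normalization forces the eigenvalues of the
  matrices \<open>H\<close> along the iteration to tend to 1. Hence \<open>H y\<^sup>* = y\<^sup>*\<close> with \<open>H\<close> built from \<open>y\<^sup>*\<close>,
  and \<open>x = e - y\<^sup>*\<close> is a nonnegative solution with \<open>x \<le> e\<close> and \<open>x \<noteq> e\<close>. Such a solution is minimal
  (\<open>minimal_if_solution_below_one\<close>): with \<open>z = e - x\<^sup>*\<close>, the vector \<open>y\<^sup>*\<close> is a positive fixed
  vector of \<open>b(\<cdot>,e) + b(x,\<cdot>)\<close>, and \<open>z\<close> is one of the matrix \<open>b(\<cdot>,e) + b(x\<^sup>*,\<cdot>)\<close>, which is
  entrywise no larger and has the zero pattern of \<open>R\<close>. This can only happen when the two matrices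
  agree, and then the fixed vectors are proportional, which makes them equal.

  If \<open>y\<^sup>* = 0\<close>, then \<open>x\<close> is \<open>e\<close> itself. Taking the inner product with \<open>w\<close>, the normalization
  reads \<open>(\<rho> - 1) (w \<bullet> y) = w \<bullet> b(y,y)\<close>; its right-hand side is of second order in \<open>y\<close>, so
  \<open>\<rho> \<le> 1\<close> (\<open>eigenvalue_le_one\<close>). In this case the same identity for \<open>e - x\<^sup>*\<close> in place
  of \<open>y\<close> leaves no room for a solution below \<open>e\<close> (\<open>one_minimal_if_eigenvalue_le_one\<close>).

  The Perron-Frobenius theory behind this reduces to one fact: a nonnegative vector \<open>v\<close> with
  \<open>A v \<le> v\<close> for an irreducible nonnegative matrix \<open>A\<close> is either zero or entrywise positive; for
  the matrices occurring here it is \<open>no_partial_support\<close>.\<close>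

section \<open>Nonnegative bilinear maps\<close>

lemma pos_vec_ge_multiple_of_one:
  fixes p :: "real ^ 'n"
  assumes "pos_vec p"
  obtains c where "0 < c" "c *\<^sub>R 1 \<le> p"
proof
  show "0 < Min (range (\<lambda>i. p $ i))"
    using assms by (auto simp: pos_vec_def)
  show "Min (range (\<lambda>i. p $ i)) *\<^sub>R 1 \<le> p"
    by (simp add: less_eq_vec_def)
qed

lemma pos_vec_imp_nonneg: "pos_vec p \<Longrightarrow> 0 \<le> p"
  by (simp add: pos_vec_def less_eq_vec_def less_imp_le)

lemma inner_nonneg_vec:
  fixes v w :: "real ^ 'n"
  shows "0 \<le> w \<Longrightarrow> 0 \<le> v \<Longrightarrow> 0 \<le> w \<bullet> v"
  by (auto simp: inner_vec_def less_eq_vec_def intro!: sum_nonneg)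

lemma inner_pos_vec_eq_0:
  fixes v w :: "real ^ 'n"
  assumes "pos_vec w" "0 \<le> v" "w \<bullet> v \<le> 0"
  shows "v = 0"
proof -
  have nn: "0 \<le> w $ i * v $ i" for i
    using assms(1,2) by (simp add: pos_vec_def less_eq_vec_def less_imp_le)
  have "(\<Sum>i\<in>UNIV. w $ i * v $ i) = 0"
    using assms(3) by (intro antisym sum_nonneg) (simp_all add: inner_vec_def nn)
  then have "w $ i * v $ i = 0" for i
    by (simp add: sum_nonneg_eq_0_iff nn)
  moreover have "w $ i \<noteq> 0" for i
    using assms(1) by (simp add: pos_vec_def less_le)
  ultimately show ?thesis
    by (simp add: vec_eq_iff)
qed

context
  fixes b :: "real ^ 'n \<Rightarrow> real ^ 'n \<Rightarrow> real ^ 'n"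
  assumes nonneg_b: "nonneg_bilinear b"
begin

lemma b_bilinear: "bilinear b"
  using nonneg_b by (simp add: nonneg_bilinear_def)

lemmas b_linear_simps =
  bilinear_ladd[OF b_bilinear] bilinear_radd[OF b_bilinear]
  bilinear_lsub[OF b_bilinear] bilinear_rsub[OF b_bilinear]
  bilinear_lmul[OF b_bilinear] bilinear_rmul[OF b_bilinear]
  bilinear_lzero[OF b_bilinear] bilinear_rzero[OF b_bilinear]

lemma b_nonneg:
  assumes "0 \<le> p" "0 \<le> q"
  shows "0 \<le> b p q"
proof -
  have "b p q = b (\<Sum>j\<in>UNIV. p $ j *\<^sub>R axis j 1) (\<Sum>k\<in>UNIV. q $ k *\<^sub>R axis k 1)"
    using basis_expansion[of p] basis_expansion[of q] by (simp add: scalar_mult_eq_scaleR)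
  also have "\<dots> = (\<Sum>(j, k)\<in>UNIV \<times> UNIV. (p $ j * q $ k) *\<^sub>R b (axis j 1) (axis k 1))"
    by (subst bilinear_sum[OF b_bilinear]) (simp add: b_linear_simps mult.commute)
  also have "0 \<le> \<dots>"
    using assms nonneg_b
    by (auto simp: less_eq_vec_def nonneg_bilinear_def intro!: sum_nonneg mult_nonneg_nonneg)
  finally show ?thesis .
qed

lemma b_mono:
  assumes "0 \<le> p" "p \<le> p'" "0 \<le> q" "q \<le> q'"
  shows "b p q \<le> b p' q'"
proof -
  have "b p' q' - b p q = b (p' - p) q' + b p (q' - q)"
    by (simp add: b_linear_simps mult.commute)
  also have "0 \<le> \<dots>"
    using assms by (intro add_nonneg_nonneg b_nonneg) (auto intro: order_trans)
  finally show ?thesis by simp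
qed

lemma b_eq_0_if_zero_at_pos:
  assumes "pos_vec p" "pos_vec q" "b p q = 0" "0 \<le> u" "0 \<le> v"
  shows "b u v = 0"
proof -
  obtain c where c: "0 < c" "c *\<^sub>R 1 \<le> p" using pos_vec_ge_multiple_of_one[OF assms(1)] .
  obtain d where d: "0 < d" "d *\<^sub>R 1 \<le> q" using pos_vec_ge_multiple_of_one[OF assms(2)] .
  have one: "(0::real ^ 'n) \<le> 1" by (simp add: less_eq_vec_def)
  have "b (c *\<^sub>R 1) (d *\<^sub>R 1) \<le> b p q"
    using c d one by (intro b_mono) (auto intro: scaleR_nonneg_nonneg)
  moreover have "0 \<le> b (c *\<^sub>R 1) (d *\<^sub>R 1)"
    using c d one by (intro b_nonneg) (auto intro: scaleR_nonneg_nonneg)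
  ultimately have "b (c *\<^sub>R 1) (d *\<^sub>R 1) = 0"
    using assms(3) by (simp add: antisym)
  then have b11: "b 1 1 = 0"
    using c d by (simp add: b_linear_simps)
  have le: "v \<le> norm v *\<^sub>R 1" for v :: "real ^ 'n"
    using component_le_norm_cart[of v] by (auto simp: less_eq_vec_def intro: abs_le_D1)
  have "b u v \<le> b (norm u *\<^sub>R 1) (norm v *\<^sub>R 1)"
    using assms(4,5) le by (intro b_mono)
  also have "\<dots> = 0" by (simp add: b_linear_simps b11)
  finally show ?thesis using b_nonneg[OF assms(4,5)] by (simp add: antisym)
qed

lemma R_mat_mult: "R_mat b *v v = b 1 v + b v 1"
  using b_bilinear
  by (simp add: R_mat_def matrix_vector_mult_add_rdistrib matrix_works bilinear_def)

lemma H_mat_mult: "H_mat b y *v v = b v 1 + b (1 - y) v"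
  using b_bilinear
  by (simp add: H_mat_def matrix_vector_mult_add_rdistrib matrix_works bilinear_def)

lemma R_mat_component: "R_mat b $ i $ j = b 1 (axis j 1) $ i + b (axis j 1) 1 $ i"
  by (simp add: R_mat_def matrix_def)

section \<open>Irreducibility and supports of subinvariant vectors\<close>

text \<open>Since \<open>p\<close> is positive, the matrix \<open>b(\<cdot>,e) + b(p,\<cdot>)\<close> has the same zero pattern as \<open>R\<close>.
  The zero set of a vector \<open>v\<close> that this matrix does not increase therefore splits \<open>R\<close> into
  blocks, which irreducibility allows only if the zero set is empty or everything.\<close>

lemma no_partial_support:
  assumes irr: "irreducible_matrix (R_mat b)"
    and p: "pos_vec p" and v: "0 \<le> v" and sub: "b v 1 + b p v \<le> v" and zero: "v $ i0 = 0"
  shows "v = 0"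
proof (rule ccontr)
  assume "v \<noteq> 0"
  define S where "S = {i. v $ i = 0}"
  have S: "S \<noteq> {}" "S \<noteq> UNIV"
    using zero \<open>v \<noteq> 0\<close> by (auto simp: S_def vec_eq_iff)
  have one: "(0::real ^ 'n) \<le> 1" by (simp add: less_eq_vec_def)
  obtain c where c: "0 < c" "c *\<^sub>R 1 \<le> p" using pos_vec_ge_multiple_of_one[OF p] .
  have "R_mat b $ i $ j = 0" if "i \<in> S" "j \<in> -S" for i j
  proof -
    have vj: "0 < v $ j"
      using that v by (auto simp: S_def less_eq_vec_def less_le)
    have ax: "(0::real ^ 'n) \<le> axis j 1" "v $ j *\<^sub>R axis j 1 \<le> v"
      using v by (auto simp: less_eq_vec_def axis_def)
    have ax0: "0 \<le> v $ j *\<^sub>R axis j (1::real)"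
      using vj ax by (simp add: scaleR_nonneg_nonneg)
    have 1: "b (v $ j *\<^sub>R axis j 1) 1 \<le> b v 1"
      using ax ax0 one by (intro b_mono) auto
    have 2: "b (c *\<^sub>R 1) (v $ j *\<^sub>R axis j 1) \<le> b p v"
      using ax ax0 c one by (intro b_mono) (auto intro: scaleR_nonneg_nonneg)
    have "b (v $ j *\<^sub>R axis j 1) 1 + b (c *\<^sub>R 1) (v $ j *\<^sub>R axis j 1) \<le> v"
      using add_mono[OF 1 2] sub by (rule order_trans)
    then have "v $ j * b (axis j 1) 1 $ i + c * v $ j * b 1 (axis j 1) $ i \<le> v $ i"
      by (simp add: less_eq_vec_def b_linear_simps mult.assoc mult.left_commute)
    moreover have "v $ i = 0" using that by (simp add: S_def)
    moreover have nn: "0 \<le> b (axis j 1) 1 $ i" "0 \<le> b 1 (axis j 1) $ i"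
      using b_nonneg[OF ax(1) one] b_nonneg[OF one ax(1)] by (auto simp: less_eq_vec_def)
    moreover have "0 \<le> v $ j * b (axis j 1) 1 $ i" "0 \<le> c * v $ j * b 1 (axis j 1) $ i"
      using nn vj c by auto
    ultimately have "v $ j * b (axis j 1) 1 $ i = 0" "c * v $ j * b 1 (axis j 1) $ i = 0"
      by linarith+
    then show ?thesis using vj c by (simp add: R_mat_component)
  qed
  with S irr show False unfolding irreducible_matrix_def by blast
qed

lemma pos_vec_if_subinvariant:
  assumes "irreducible_matrix (R_mat b)" "pos_vec p" "0 \<le> v" "b v 1 + b p v \<le> v" "v \<noteq> 0"
  shows "pos_vec v"
  using no_partial_support[OF assms(1-4)] assms(3,5)
  by (auto simp: pos_vec_def less_eq_vec_def less_le)

section \<open>Solutions in terms of their distance to one\<close>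

context
  fixes a :: "real ^ 'n"
  assumes one_solution: "1 = a + b 1 1"
begin

lemma solution_iff_complement:
  "x = a + b x x \<longleftrightarrow> 1 - x = b (1 - x) 1 + b x (1 - x)"
proof -
  have a: "a = 1 - b 1 1" using one_solution by (simp add: eq_diff_eq)
  show ?thesis by (subst a) (auto simp: b_linear_simps algebra_simps)
qed

lemma minimal_solution_le_one:
  assumes "minimal_nonneg_solution a b xs"
  shows "xs \<le> 1"
proof -
  have "(0::real ^ 'n) \<le> 1" by (simp add: less_eq_vec_def)
  with assms one_solution show ?thesis unfolding minimal_nonneg_solution_def by blast
qed

text \<open>With \<open>u = e - x\<close> and \<open>z = e - x\<^sup>*\<close>, let \<open>t\<close> be the least number with \<open>z \<le> t u\<close>. The vector
  \<open>t u - z\<close> is not increased by \<open>b(\<cdot>,e) + b(x\<^sup>*,\<cdot>)\<close>, the defect being \<open>t b(x - x\<^sup>*,u)\<close>, and it has a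
  zero entry; so it vanishes, and with it the defect. As \<open>x - x\<^sup>* = (t - 1) u\<close>, either \<open>t = 1\<close> or
  \<open>b(u,u) = 0\<close>, and the latter would make \<open>b\<close> zero and so \<open>u\<close> zero.\<close>

lemma minimal_if_solution_below_one:
  assumes min: "minimal_nonneg_solution a b xs" and irr: "irreducible_matrix (R_mat b)"
    and pos: "pos_vec xs"
    and x: "0 \<le> x" "x = a + b x x" "x \<le> 1" "x \<noteq> 1"
  shows "minimal_nonneg_solution a b x"
proof -
  define u where "u = 1 - x"
  define z where "z = 1 - xs"
  have one: "(0::real ^ 'n) \<le> 1" by (simp add: less_eq_vec_def)
  have "xs \<le> x" and xs: "xs = a + b xs xs"
    using min x by (auto simp: minimal_nonneg_solution_def)
  then have uz: "u \<le> z" by (simp add: u_def z_def)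
  have "pos_vec x"
    using \<open>xs \<le> x\<close> pos by (auto simp: pos_vec_def less_eq_vec_def intro: less_le_trans)
  have u: "b u 1 + b x u = u" and z: "b z 1 + b xs z = z"
    using x(2) xs unfolding solution_iff_complement u_def z_def by simp_all
  have "0 \<le> u" "u \<noteq> 0" using x by (auto simp: u_def)
  then have "pos_vec u"
    using pos_vec_if_subinvariant[OF irr \<open>pos_vec x\<close>] u by simp
  then have upos: "0 < u $ i" for i by (simp add: pos_vec_def)
  define t where "t = Max (range (\<lambda>i. z $ i / u $ i))"
  have "t \<in> range (\<lambda>i. z $ i / u $ i)" unfolding t_def by (rule Max_in) auto
  then obtain i0 where i0: "t = z $ i0 / u $ i0" by blast
  have "z $ i / u $ i \<le> t" for i unfolding t_def by (rule Max_ge) auto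
  then have ztu: "z $ i \<le> t * u $ i" for i
    using upos[of i] by (simp add: divide_le_eq)
  define v where "v = t *\<^sub>R u - z"
  have "0 \<le> v" using ztu by (simp add: v_def less_eq_vec_def)
  have "v $ i0 = 0" using i0 upos[of i0] by (simp add: v_def)
  have "0 \<le> z $ i0"
    using uz upos[of i0] by (auto simp: less_eq_vec_def intro: order_trans less_imp_le)
  then have "0 \<le> t" using i0 upos[of i0] by simp
  have xxs: "x = xs + (z - u)" by (simp add: u_def z_def)
  have "v = t *\<^sub>R (b u 1 + b x u) - (b z 1 + b xs z)"
    by (simp add: u z v_def)
  also have "\<dots> = b v 1 + b xs v + t *\<^sub>R b (z - u) u"
    by (subst xxs) (simp add: v_def b_linear_simps scaleR_add_right scaleR_diff_right)
  finally have defect: "v = b v 1 + b xs v + t *\<^sub>R b (z - u) u" .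
  have "0 \<le> t *\<^sub>R b (z - u) u"
    using \<open>0 \<le> t\<close> uz \<open>0 \<le> u\<close> by (intro scaleR_nonneg_nonneg b_nonneg) auto
  then have "b v 1 + b xs v \<le> v"
    using defect by (metis le_add_same_cancel1)
  then have "v = 0"
    using no_partial_support[OF irr pos \<open>0 \<le> v\<close> _ \<open>v $ i0 = 0\<close>] by simp
  then have "t *\<^sub>R b (z - u) u = 0" using defect by (simp add: b_linear_simps)
  moreover have ztu': "z = t *\<^sub>R u" using \<open>v = 0\<close> by (simp add: v_def)
  moreover have "t \<noteq> 0"
  proof
    assume "t = 0"
    then have "u $ i0 \<le> 0" using ztu' uz by (simp add: less_eq_vec_def)
    then show False using upos[of i0] by simp
  qed
  ultimately have "b (z - u) u = 0" by simp
  moreover have "z - u = (t - 1) *\<^sub>R u" using ztu' by (simp add: scaleR_diff_left)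
  ultimately have "(t - 1) *\<^sub>R b u u = 0"
    by (simp only: b_linear_simps)
  moreover have "b u u \<noteq> 0"
  proof
    assume "b u u = 0"
    then have "b u 1 + b x u = 0"
      using b_eq_0_if_zero_at_pos[OF \<open>pos_vec u\<close> \<open>pos_vec u\<close>] one x(1) \<open>0 \<le> u\<close> by simp
    with u \<open>u \<noteq> 0\<close> show False by simp
  qed
  ultimately have "z = u" using ztu' by simp
  then have "x = xs" by (simp add: u_def z_def)
  with min show ?thesis by simp
qed

end

section \<open>The role of the left eigenvector\<close>

context
  fixes w :: "real ^ 'n" and \<rho> :: real
  assumes w_pos: "pos_vec w"
    and w_left_eigenvector: "transpose (R_mat b) *v w = \<rho> *s w"
begin

lemma w_inner_R: "w \<bullet> (b 1 v + b v 1) = \<rho> * (w \<bullet> v)"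
proof -
  have "w \<bullet> (R_mat b *v v) = (transpose (R_mat b) *v w) \<bullet> v"
    by (simp only: transpose_matrix_vector dot_lmul_matrix)
  then show ?thesis
    by (simp only: R_mat_mult w_left_eigenvector scalar_mult_eq_scaleR inner_scaleR_left)
qed

text \<open>Pairing the equation for \<open>z = e - x\<^sup>*\<close> with \<open>w\<close> gives
  \<open>w \<bullet> b(z,z) = (\<rho> - 1) (w \<bullet> z) \<le> 0\<close>, hence \<open>b(z,z) = 0\<close>. A nonzero \<open>z\<close> would then be fixed
  by \<open>R\<close>, hence positive, so that \<open>b\<close> and then \<open>z\<close> would be zero after all.\<close>

lemma one_minimal_if_eigenvalue_le_one:
  assumes one_solution: "1 = a + b 1 1"
    and min: "minimal_nonneg_solution a b xs" and irr: "irreducible_matrix (R_mat b)"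
    and le: "\<rho> \<le> 1"
  shows "minimal_nonneg_solution a b 1"
proof -
  define z where "z = 1 - xs"
  have one: "(0::real ^ 'n) \<le> 1" "pos_vec (1::real ^ 'n)"
    by (simp_all add: less_eq_vec_def pos_vec_def)
  have "0 \<le> z" using minimal_solution_le_one[OF one_solution min] by (simp add: z_def)
  have "xs = a + b xs xs" using min by (simp add: minimal_nonneg_solution_def)
  then have "z = b z 1 + b xs z" unfolding solution_iff_complement[OF one_solution] z_def .
  moreover have "xs = 1 - z" by (simp add: z_def)
  ultimately have z: "z + b z z = b 1 z + b z 1" by (simp add: b_linear_simps algebra_simps)
  then have "w \<bullet> z + w \<bullet> b z z = \<rho> * (w \<bullet> z)"
    by (metis inner_add_right w_inner_R)
  moreover have "\<rho> * (w \<bullet> z) \<le> 1 * (w \<bullet> z)"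
    using le \<open>0 \<le> z\<close> inner_nonneg_vec[OF pos_vec_imp_nonneg[OF w_pos]]
    by (intro mult_right_mono)
  ultimately have "b z z = 0"
    using inner_pos_vec_eq_0[OF w_pos b_nonneg[OF \<open>0 \<le> z\<close> \<open>0 \<le> z\<close>]] by simp
  with z have fixed: "b z 1 + b 1 z = z" by (simp add: add.commute)
  have "z = 0"
  proof (rule ccontr)
    assume "z \<noteq> 0"
    then have "pos_vec z"
      using pos_vec_if_subinvariant[OF irr one(2) \<open>0 \<le> z\<close>] fixed by simp
    then have "b z 1 + b 1 z = 0"
      using b_eq_0_if_zero_at_pos[OF _ _ \<open>b z z = 0\<close>] one \<open>0 \<le> z\<close> by simp
    with fixed \<open>z \<noteq> 0\<close> show False by simp
  qed
  then have "xs = 1" by (simp add: z_def)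
  with min show ?thesis by simp
qed

text \<open>For \<open>v \<le> \<delta> e\<close> the quadratic term satisfies \<open>b(v,v) \<le> \<delta> R v\<close>, so the normalization gives
  \<open>\<rho> - 1 \<le> \<delta> \<rho>\<close>; small normalized vectors make \<open>\<delta>\<close> arbitrarily small.\<close>

lemma eigenvalue_le_one:
  assumes v_pos: "\<And>k. pos_vec (v k)"
    and normalized: "\<And>k. w \<bullet> (v k - b (v k) 1 - b 1 (v k) + b (v k) (v k)) = 0"
    and lim: "v \<longlonglongrightarrow> (0 :: real ^ 'n)"
  shows "\<rho> \<le> 1"
proof (rule ccontr)
  assume "\<not> \<rho> \<le> 1"
  then have "1 < \<rho>" by simp
  \<comment> \<open>Then \<open>\<delta> \<rho>\<close> is half of \<open>\<rho> - 1\<close>.\<close>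
  define \<delta> where "\<delta> = (\<rho> - 1) / (2 * \<rho>)"
  have "0 < \<delta>" using \<open>1 < \<rho>\<close> by (simp add: \<delta>_def)
  with lim obtain k where "norm (v k) < \<delta>"
    unfolding LIMSEQ_iff by (metis diff_zero order_refl)
  define q where "q = v k"
  have "0 \<le> q" "q \<noteq> 0"
    using v_pos[of k] by (auto simp: q_def pos_vec_def less_eq_vec_def less_imp_le)
  have "q \<le> \<delta> *\<^sub>R 1"
    using \<open>norm (v k) < \<delta>\<close> component_le_norm_cart[of q]
    by (auto simp: less_eq_vec_def q_def intro: order_trans[OF abs_ge_self] order_trans less_imp_le)
  have one: "(0::real ^ 'n) \<le> 1" by (simp add: less_eq_vec_def)
  have "b q q \<le> b (\<delta> *\<^sub>R 1) q"
    using \<open>0 \<le> q\<close> \<open>q \<le> \<delta> *\<^sub>R 1\<close> by (intro b_mono) auto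
  also have "\<dots> = \<delta> *\<^sub>R b 1 q" by (simp add: b_linear_simps)
  also have "\<dots> \<le> \<delta> *\<^sub>R (b 1 q + b q 1)"
    using \<open>0 < \<delta>\<close> b_nonneg[OF \<open>0 \<le> q\<close> one] by (intro scaleR_left_mono) auto
  finally have "0 \<le> w \<bullet> (\<delta> *\<^sub>R (b 1 q + b q 1) - b q q)"
    by (intro inner_nonneg_vec pos_vec_imp_nonneg[OF w_pos]) simp
  then have "w \<bullet> b q q \<le> \<delta> * (\<rho> * (w \<bullet> q))"
    using w_inner_R by (simp add: inner_diff_right)
  moreover have "w \<bullet> q - \<rho> * (w \<bullet> q) + w \<bullet> b q q = 0"
    using normalized[of k] w_inner_R[of q]
    by (simp add: q_def inner_diff_right inner_add_right)
  ultimately have "(\<rho> - 1) * (w \<bullet> q) \<le> \<delta> * \<rho> * (w \<bullet> q)"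
    by (simp add: algebra_simps)
  moreover have "0 < w \<bullet> q"
    using inner_pos_vec_eq_0[OF w_pos \<open>0 \<le> q\<close>] \<open>q \<noteq> 0\<close> by linarith
  ultimately have "\<rho> - 1 \<le> \<delta> * \<rho>" by simp
  also have "\<delta> * \<rho> = (\<rho> - 1) / 2" using \<open>1 < \<rho>\<close> by (simp add: \<delta>_def field_simps)
  finally show False using \<open>1 < \<rho>\<close> by simp
qed

end

section \<open>Limits of the iteration\<close>

text \<open>In the limit the normalization says \<open>w \<bullet> H y\<^sup>* = w \<bullet> y\<^sup>*\<close>. As \<open>w \<bullet> y\<^sup>*\<close> is positive,
  the eigenvalues, being the quotients of \<open>w \<bullet> H y\<close> and \<open>w \<bullet> y\<close>, tend to 1.\<close>

lemma perron_iteration_limit_fixed: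
  assumes w: "pos_vec w" and iter: "perron_iteration b w y" and lim: "y \<longlonglongrightarrow> ys"
    and ys: "0 \<le> ys" "ys \<noteq> 0"
  shows "b ys 1 + b (1 - ys) ys = ys"
proof -
  define \<mu> where "\<mu> k = spectral_radius (H_mat b (y k))" for k
  define h where "h k = b (y (Suc k)) 1 + b (1 - y k) (y (Suc k))" for k
  define hs where "hs = b ys 1 + b (1 - ys) ys"
  note tendsto_b = bounded_bilinear.tendsto[OF b_bilinear[unfolded bilinear_conv_bounded_bilinear]]
  have limS: "(\<lambda>k. y (Suc k)) \<longlonglongrightarrow> ys" using lim by (rule LIMSEQ_Suc)
  have eigen: "h k = \<mu> k *\<^sub>R y (Suc k)" for k
    using iter H_mat_mult
    by (simp add: perron_iteration_def perron_vector_def h_def \<mu>_def scalar_mult_eq_scaleR)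
  have "h \<longlonglongrightarrow> hs"
    unfolding h_def hs_def by (intro tendsto_intros tendsto_b lim limS)
  have "(\<lambda>k. w \<bullet> (y (Suc k) - b (y (Suc k)) 1 - b 1 (y (Suc k)) + b (y (Suc k)) (y (Suc k))))
      \<longlonglongrightarrow> w \<bullet> (ys - b ys 1 - b 1 ys + b ys ys)"
    by (intro tendsto_intros tendsto_b limS)
  then have "w \<bullet> (ys - b ys 1 - b 1 ys + b ys ys) = 0"
    using iter by (simp add: perron_iteration_def LIMSEQ_const_iff)
  then have w_eq: "w \<bullet> hs = w \<bullet> ys"
    by (simp add: hs_def b_linear_simps algebra_simps)
  have "0 < w \<bullet> ys"
    using inner_pos_vec_eq_0[OF w ys(1)] ys(2) by linarith
  have wy_pos: "0 < w \<bullet> y (Suc k)" for k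
  proof -
    have "pos_vec (y (Suc k))" using iter by (simp add: perron_iteration_def)
    then have "0 \<le> y (Suc k)" "y (Suc k) \<noteq> 0"
      by (auto simp: pos_vec_def less_eq_vec_def less_imp_le)
    then show ?thesis using inner_pos_vec_eq_0[OF w] by fastforce
  qed
  have "\<mu> = (\<lambda>k. (w \<bullet> h k) / (w \<bullet> y (Suc k)))"
    using wy_pos by (auto simp: eigen fun_eq_iff less_le)
  moreover have "(\<lambda>k. (w \<bullet> h k) / (w \<bullet> y (Suc k))) \<longlonglongrightarrow> (w \<bullet> hs) / (w \<bullet> ys)"
    using \<open>0 < w \<bullet> ys\<close> by (intro tendsto_intros \<open>h \<longlonglongrightarrow> hs\<close> limS) simp
  ultimately have "\<mu> \<longlonglongrightarrow> 1"
    using w_eq \<open>0 < w \<bullet> ys\<close> by simp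
  then have "(\<lambda>k. \<mu> k *\<^sub>R y (Suc k)) \<longlonglongrightarrow> 1 *\<^sub>R ys"
    by (intro tendsto_intros limS)
  then have "h \<longlonglongrightarrow> ys"
    by (simp add: eigen[symmetric])
  with \<open>h \<longlonglongrightarrow> hs\<close> show ?thesis
    unfolding hs_def by (rule LIMSEQ_unique)
qed

end

theorem theorem3:
  fixes a xs w ys :: "real ^ 'n"
    and b :: "real ^ 'n \<Rightarrow> real ^ 'n \<Rightarrow> real ^ 'n"
    and y :: "nat \<Rightarrow> real ^ 'n"
  assumes "0 \<le> a"
    and "nonneg_bilinear b"
    and "1 = a + b 1 1"
    and "minimal_nonneg_solution a b xs"
    and "irreducible_matrix (R_mat b)"
    and "pos_vec xs"
    and "perron_vector (transpose (R_mat b)) w"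
    and "perron_iteration b w y"
    and "y \<longlonglongrightarrow> ys"
    and "ys \<le> 1"
  shows "minimal_nonneg_solution a b (1 - ys)"
proof -
  have w: "pos_vec w"
      "transpose (R_mat b) *v w = spectral_radius (transpose (R_mat b)) *s w"
    using assms(7) by (simp_all add: perron_vector_def)
  have y_pos: "pos_vec (y k)" for k
    using assms(8) by (simp add: perron_iteration_def)
  have "0 \<le> ys $ i" for i
  proof (rule LIMSEQ_le_const)
    show "(\<lambda>k. y k $ i) \<longlonglongrightarrow> ys $ i" using assms(9) by (rule tendsto_vec_nth)
    show "\<exists>K. \<forall>k\<ge>K. 0 \<le> y k $ i" using y_pos by (auto simp: pos_vec_def less_imp_le)
  qed
  then have "0 \<le> ys" by (simp add: less_eq_vec_def)
  show ?thesis
  proof (cases "ys = 0")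
    case True
    \<comment> \<open>The vector \<open>y 0\<close> need not be normalized, so the estimate is applied to the shifted sequence.\<close>
    have "spectral_radius (transpose (R_mat b)) \<le> 1"
    proof (rule eigenvalue_le_one[OF assms(2) w])
      show "(\<lambda>k. y (Suc k)) \<longlonglongrightarrow> 0" using LIMSEQ_Suc[OF assms(9)] True by simp
      show "w \<bullet> (y (Suc k) - b (y (Suc k)) 1 - b 1 (y (Suc k)) + b (y (Suc k)) (y (Suc k))) = 0"
        for k using assms(8) by (simp add: perron_iteration_def)
    qed (rule y_pos)
    then show ?thesis
      using one_minimal_if_eigenvalue_le_one[OF assms(2) w assms(3-5)] True by simp
  next
    case False
    have "b ys 1 + b (1 - ys) ys = ys"
      using perron_iteration_limit_fixed[OF assms(2) w(1) assms(8,9) \<open>0 \<le> ys\<close> False] .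
    then have "1 - ys = a + b (1 - ys) (1 - ys)"
      by (simp add: solution_iff_complement[OF assms(2,3)])
    then show ?thesis
      using minimal_if_solution_below_one[OF assms(2-6)] assms(10) \<open>0 \<le> ys\<close> False by simp
  qed
qed

end
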